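(* For every integer $k \ge 1$, there exists a quasi-perfect $2$-error-correcting code in each of the following Cartesian products: (1) $C_{14} \square C_{14} \square C_{4k}$; (2) $C_n \square C_n \square C_{6k}$ for every $n$ with $14 \le n \le 19$.
   Context: All graphs are simple and connected; $d(x,y)$ is the shortest-path distance. For $n\ge 3$, $C_n$ is the cycle on $n$ vertices. The Cartesian product $G\square H$ has vertex set $V(G)\times V(H)$, with $(g_1,h_1)$ adjacent to $(g_2,h_2)$ iff either $h_1=h_2$ and $g_1g_2\in E(G)$, or $g_1=g_2$ and $h_1h_2\in E(H)$. A code is a subset $D$ of the vertex set. $D$ is $t$-error-correcting if any two distinct codewords are at distance at least $2t+1$. The covering radius of $D$ is the smallest $r$ such that every vertex is at distance at most $r$ from some codeword. A quasi-perfect $t$-error-correcting code is a $t$-error-correcting code with covering radius $t+1$. *)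

theory Defs
  imports "Graph_Theory.Graph_Theory"
begin

text \<open>A simple graph is a \<^locale>\<open>pair_graph\<close>: an edge is represented by its two opposite arcs.\<close>

definition cycle_graph :: "nat \<Rightarrow> nat pair_pre_digraph" where
  "cycle_graph n = \<lparr> pverts = {..<n},
     parcs = {(i, j). i < n \<and> j < n \<and> (j = (i + 1) mod n \<or> i = (j + 1) mod n)} \<rparr>"

definition cartesian_product ::
    "'a pair_pre_digraph \<Rightarrow> 'b pair_pre_digraph \<Rightarrow> ('a \<times> 'b) pair_pre_digraph"
    (infixl \<open>\<box>\<close> 75) where
  "G \<box> H = \<lparr> pverts = pverts G \<times> pverts H,
     parcs = {((g1, h1), (g2, h2)).
        (h1 = h2 \<and> h1 \<in> pverts H \<and> (g1, g2) \<in> parcs G) \<or>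
        (g1 = g2 \<and> g1 \<in> pverts G \<and> (h1, h2) \<in> parcs H)} \<rparr>"

definition graph_dist :: "('a, 'b) pre_digraph \<Rightarrow> 'a \<Rightarrow> 'a \<Rightarrow> ereal" where
  "graph_dist G u v = wf_digraph.\<mu> G (\<lambda>_. 1) u v"

definition error_correcting :: "('a, 'b) pre_digraph \<Rightarrow> nat \<Rightarrow> 'a set \<Rightarrow> bool" where
  "error_correcting G t D \<longleftrightarrow> D \<subseteq> verts G \<and>
     (\<forall>x\<in>D. \<forall>y\<in>D. x \<noteq> y \<longrightarrow> ereal (real (2 * t + 1)) \<le> graph_dist G x y)"

definition covers :: "('a, 'b) pre_digraph \<Rightarrow> 'a set \<Rightarrow> nat \<Rightarrow> bool" where
  "covers G D r \<longleftrightarrow> (\<forall>v\<in>verts G. \<exists>c\<in>D. graph_dist G v c \<le> ereal (real r))"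

text \<open>A relation rather than a function, since the empty code has no covering radius.\<close>

definition has_covering_radius :: "('a, 'b) pre_digraph \<Rightarrow> 'a set \<Rightarrow> nat \<Rightarrow> bool" where
  "has_covering_radius G D r \<longleftrightarrow> covers G D r \<and> (\<forall>r'. covers G D r' \<longrightarrow> r \<le> r')"

definition quasi_perfect :: "('a, 'b) pre_digraph \<Rightarrow> nat \<Rightarrow> 'a set \<Rightarrow> bool" where
  "quasi_perfect G t D \<longleftrightarrow> error_correcting G t D \<and> has_covering_radius G D (t + 1)"

lemma pair_graph_cycle_graph:
  assumes "n \<ge> 3"
  shows "pair_graph (cycle_graph n)"
proof
  show "finite (parcs (cycle_graph n))"
    by (rule finite_subset[of _ "{..<n} \<times> {..<n}"]) (auto simp: cycle_graph_def)
  show "symmetric (with_proj (cycle_graph n))"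
    by (auto simp: cycle_graph_def symmetric_def sym_def arcs_ends_def arc_to_ends_def image_def)
  show "fst e \<noteq> snd e" if "e \<in> parcs (cycle_graph n)" for e
    using that assms by (auto simp: cycle_graph_def mod_Suc split: if_splits)
qed (auto simp: cycle_graph_def)

lemma pair_graph_cartesian_product:
  assumes "pair_graph G" "pair_graph H"
  shows "pair_graph (G \<box> H)"
proof -
  interpret G: pair_graph G by fact
  interpret H: pair_graph H by fact
  have symG: "(y, x) \<in> parcs G" if "(x, y) \<in> parcs G" for x y
    using G.pair_sym_arcs that by (auto simp: symmetric_def dest: symD)
  have symH: "(y, x) \<in> parcs H" if "(x, y) \<in> parcs H" for x y
    using H.pair_sym_arcs that by (auto simp: symmetric_def dest: symD)
  have sub: "parcs (G \<box> H) \<subseteq> (pverts G \<times> pverts H) \<times> (pverts G \<times> pverts H)"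
    by (auto simp: cartesian_product_def
        dest: G.arc_fst_in_verts G.arc_snd_in_verts H.arc_fst_in_verts H.arc_snd_in_verts)
  show ?thesis
  proof
    show "finite (pverts (G \<box> H))" by (simp add: cartesian_product_def)
    show "finite (parcs (G \<box> H))"
      by (rule finite_subset[OF sub]) simp
    show "fst e \<in> pverts (G \<box> H)" "snd e \<in> pverts (G \<box> H)" if "e \<in> parcs (G \<box> H)" for e
      using subsetD[OF sub that] by (auto simp: cartesian_product_def)
    show "fst e \<noteq> snd e" if "e \<in> parcs (G \<box> H)" for e
      using that G.no_loops H.no_loops by (auto simp: cartesian_product_def)
    show "symmetric (with_proj (G \<box> H))"
      by (auto simp: symmetric_def sym_def cartesian_product_def symG symH)
  qed
qed

lemma graph_dist_eq_INF:
  assumes "pair_graph G"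
  shows "graph_dist (with_proj G) u v =
    (INF p\<in>{p. pre_digraph.awalk (with_proj G) u p v}. ereal (real (length p)))"
proof -
  interpret pair_graph G by fact
  have "awalk_cost (\<lambda>_. 1) p = real (length p)" for p
    by (induction p) auto
  then show ?thesis by (simp add: graph_dist_def \<mu>_def)
qed

end

theory Submission
  imports Defs "HOL-Library.Code_Binary_Nat"
begin

text \<open>
  Distances in the product are sums of cyclic distances. A code in
  \<open>C\<^sub>n \<box> C\<^sub>n \<box> C\<^sub>m\<close> is a cyclic sequence of \<open>m\<close> layers, each a subset of
  \<open>C\<^sub>n \<box> C\<^sub>n\<close>, and the packing and covering conditions at a vertex see only the layers at distance
  at most 4 and 3. If the layers carry labels and consecutive labels follow a finite transition graph,
  it therefore suffices to check the finitely many short walks of that graph, whatever \<open>m\<close> is.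

  For \<open>n = 14\<close> put \<open>A = {(x, y). y = 4x}\<close> and \<open>B = {(x, y). y = 4x + 7}\<close> modulo 14. Balls of radius 2
  around \<open>A\<close> miss exactly \<open>B\<close> and conversely, so the layers \<open>A\<close> and \<open>B\<close> may alternate at distances 2
  and 3, as long as no two consecutive distances are 2. The blocks \<open>A--B--\<close> and \<open>A-B--\<close> (a dash is an
  empty layer) thus give codes for every \<open>m = 6a + 5b > 0\<close>, in particular for \<open>m = 6k\<close> and for
  \<open>m = 4k\<close> with \<open>k \<ge> 3\<close>. The sequence \<open>A-B-\<close> works in \<open>C\<^sub>4\<close>, where the two copies of \<open>A\<close> at
  distance 4 coincide, and \<open>m = 8\<close> needs a separate code. For \<open>15 \<le> n \<le> 19\<close> one code with six layers
  is repeated periodically.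
\<close>

section \<open>Distances in products of cycles\<close>

text \<open>A local description that determines the graph distance and passes easily to products:
  \<open>d\<close> falls by at most one along an arc, and between distinct vertices some arc attains
  this fall.\<close>

definition step_metric :: "'a pair_pre_digraph \<Rightarrow> ('a \<Rightarrow> 'a \<Rightarrow> nat) \<Rightarrow> bool" where
  "step_metric G d \<longleftrightarrow>
     (\<forall>u\<in>pverts G. \<forall>v\<in>pverts G. d u v = 0 \<longleftrightarrow> u = v) \<and>
     (\<forall>(u, u')\<in>parcs G. \<forall>v\<in>pverts G. d u v \<le> Suc (d u' v)) \<and>
     (\<forall>u\<in>pverts G. \<forall>v\<in>pverts G. u \<noteq> v \<longrightarrow> (\<exists>u'. (u, u') \<in> parcs G \<and> d u v = Suc (d u' v)))"

text \<open>As \<open>d\<close> falls by at most one per arc, every walk has at least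
  \<open>d u v\<close> arcs; descending greedily gives a walk with exactly that many.\<close>

lemma graph_dist_step_metric:
  assumes G: "pair_graph G" and d: "step_metric G d"
    and u: "u \<in> pverts G" and v: "v \<in> pverts G"
  shows "graph_dist (with_proj G) u v = ereal (real (d u v))"
proof -
  interpret pair_graph G by fact
  have lower: "d u v \<le> length p" if "awalk u p v" for u p
    using that
  proof (induction p arbitrary: u)
    case Nil
    then show ?case using d v by (auto simp: awalk_Nil_iff step_metric_def)
  next
    case (Cons e p)
    obtain a b where e: "e = (a, b)" by (cases e)
    from Cons.prems e have "a = u" "(u, b) \<in> parcs G" "awalk b p v"
      by (auto simp: awalk_Cons_iff)
    with d v have "d u v \<le> Suc (d b v)" by (auto simp: step_metric_def)
    with Cons.IH[OF \<open>awalk b p v\<close>] show ?case by simp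
  qed
  have upper: "\<exists>p. awalk u p v \<and> length p = d u v" if "u \<in> pverts G" for u
    using that
  proof (induction "d u v" arbitrary: u)
    case 0
    then have "u = v" using d v by (auto simp: step_metric_def)
    then have "awalk u [] v" using v by (simp add: awalk_Nil_iff)
    with 0 show ?case by (metis list.size(3))
  next
    case (Suc k)
    have "d v v = 0" using d v by (simp add: step_metric_def)
    then have "u \<noteq> v" using Suc.hyps(2) by auto
    then obtain u' where u': "(u, u') \<in> parcs G" "d u v = Suc (d u' v)"
      using Suc.prems d v unfolding step_metric_def by blast
    then have "u' \<in> pverts G" using arc_snd_in_verts[of "(u, u')"] by simp
    moreover have "k = d u' v" using Suc.hyps(2) u'(2) by simp
    ultimately obtain p where "awalk u' p v" "length p = d u' v"
      using Suc.hyps(1) by blast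
    then have "awalk u ((u, u') # p) v" "length ((u, u') # p) = d u v"
      using u' by (auto simp: awalk_Cons_iff)
    then show ?case by blast
  qed
  obtain p where p: "awalk u p v" "length p = d u v" using upper[OF u] by blast
  show ?thesis
    unfolding graph_dist_eq_INF[OF G]
  proof (rule antisym)
    show "(INF p\<in>{p. awalk u p v}. ereal (real (length p))) \<le> ereal (real (d u v))"
      using p by (metis (mono_tags, lifting) INF_lower mem_Collect_eq)
    show "ereal (real (d u v)) \<le> (INF p\<in>{p. awalk u p v}. ereal (real (length p)))"
      using lower by (auto intro!: INF_greatest)
  qed
qed

text \<open>An arc moves one coordinate only; a descent corrects the first coordinate before the
  second.\<close>

lemma step_metric_cartesian_product:
  assumes "pair_graph G" "pair_graph H" and d: "step_metric G d" and e: "step_metric H e"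
  shows "step_metric (G \<box> H) (\<lambda>(a, b) (a', b'). d a a' + e b b')"
proof -
  interpret G: pair_graph G by fact
  interpret H: pair_graph H by fact
  have "\<exists>u'. ((a, b), u') \<in> parcs (G \<box> H) \<and>
      d a a' + e b b' = Suc (case u' of (x, y) \<Rightarrow> d x a' + e y b')"
    if V: "a \<in> pverts G" "a' \<in> pverts G" "b \<in> pverts H" "b' \<in> pverts H"
      and ne: "(a, b) \<noteq> (a', b')" for a b a' b'
  proof (cases "a = a'")
    case False
    then obtain x where "(a, x) \<in> parcs G" "d a a' = Suc (d x a')"
      using d V unfolding step_metric_def by blast
    then show ?thesis using V
      by (intro exI[of _ "(x, b)"]) (auto simp: cartesian_product_def)
  next
    case True
    then have "b \<noteq> b'" using ne by simp
    then obtain y where "(b, y) \<in> parcs H" "e b b' = Suc (e y b')"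
      using e V unfolding step_metric_def by blast
    then show ?thesis using V
      by (intro exI[of _ "(a, y)"]) (auto simp: cartesian_product_def)
  qed
  moreover have "d a a' + e b b' \<le> Suc (d x a' + e y b')"
    if "((a, b), (x, y)) \<in> parcs (G \<box> H)" "a' \<in> pverts G" "b' \<in> pverts H" for a b x y a' b'
    using that d e by (fastforce simp: cartesian_product_def step_metric_def)
  moreover have "d a a' + e b b' = 0 \<longleftrightarrow> (a, b) = (a', b')"
    if "a \<in> pverts G" "a' \<in> pverts G" "b \<in> pverts H" "b' \<in> pverts H" for a b a' b'
    using that d e by (auto simp: step_metric_def)
  moreover have "pverts (G \<box> H) = pverts G \<times> pverts H"
    by (simp add: cartesian_product_def)
  ultimately show ?thesis unfolding step_metric_def by (auto split: prod.splits)
qed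

section \<open>Distance in a single cycle\<close>

definition absdiff :: "nat \<Rightarrow> nat \<Rightarrow> nat" where
  "absdiff x y = (if x \<le> y then y - x else x - y)"

definition cyc_dist :: "nat \<Rightarrow> nat \<Rightarrow> nat \<Rightarrow> nat" where
  "cyc_dist n x y = (let d = absdiff x y in min d (n - d))"

lemma cyc_dist_sym: "cyc_dist n x y = cyc_dist n y x"
  by (simp add: cyc_dist_def absdiff_def Let_def)

lemma cyc_dist_le: "x \<le> y \<Longrightarrow> cyc_dist n x y = min (y - x) (n - (y - x))"
  by (simp add: cyc_dist_def absdiff_def Let_def)

lemma cyc_dist_ge: "y \<le> x \<Longrightarrow> cyc_dist n x y = min (x - y) (n - (x - y))"
  by (simp add: cyc_dist_def absdiff_def Let_def)

lemma cyc_dist_Suc: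
  assumes "Suc u < n" "v < n"
  shows "cyc_dist n u v \<le> Suc (cyc_dist n (Suc u) v)" "cyc_dist n (Suc u) v \<le> Suc (cyc_dist n u v)"
  using assms by (cases "v \<le> u"; auto simp: cyc_dist_le cyc_dist_ge min_def)+

lemma cyc_dist_wrap:
  assumes "v < n"
  shows "cyc_dist n (n - 1) v \<le> Suc (cyc_dist n 0 v)" "cyc_dist n 0 v \<le> Suc (cyc_dist n (n - 1) v)"
  using assms by (auto simp: cyc_dist_le cyc_dist_ge min_def)

text \<open>Stepping along the shorter arc towards \<open>v\<close> lowers the distance;
  \<open>f\<close> and \<open>b\<close> are the forward and backward neighbours of
  \<open>u\<close>.\<close>

lemma cyc_dist_neighbour:
  assumes "u < n" "v < n" "u \<noteq> v"
  defines "f \<equiv> (if Suc u = n then 0 else Suc u)" and "b \<equiv> (if u = 0 then n - 1 else u - 1)"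
  shows "cyc_dist n u v = Suc (cyc_dist n f v) \<or> cyc_dist n u v = Suc (cyc_dist n b v)"
proof (cases "u < v")
  case True
  show ?thesis
  proof (cases "2 * (v - u) \<le> n")
    case le: True
    then have "cyc_dist n u v = Suc (cyc_dist n f v)"
      using True assms(1-3) by (auto simp: cyc_dist_le min_def f_def)
    then show ?thesis ..
  next
    case False
    then have "cyc_dist n u v = Suc (cyc_dist n b v)"
      using True assms(1-3) by (auto simp: cyc_dist_le cyc_dist_ge min_def b_def)
    then show ?thesis ..
  qed
next
  case False
  then have vu: "v < u" using assms by simp
  show ?thesis
  proof (cases "2 * (u - v) \<le> n")
    case True
    then have "cyc_dist n u v = Suc (cyc_dist n b v)"
      using vu assms(1-3) by (auto simp: cyc_dist_ge min_def b_def)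
    then show ?thesis ..
  next
    case False
    then have "cyc_dist n u v = Suc (cyc_dist n f v)"
      using vu assms(1-3) by (auto simp: cyc_dist_le cyc_dist_ge min_def f_def)
    then show ?thesis ..
  qed
qed

lemma step_metric_cycle_graph:
  assumes "n \<ge> 3"
  shows "step_metric (cycle_graph n) (cyc_dist n)"
proof -
  have "\<exists>u'. (u, u') \<in> parcs (cycle_graph n) \<and> cyc_dist n u v = Suc (cyc_dist n u' v)"
    if uv: "u < n" "v < n" "u \<noteq> v" for u v
  proof -
    have "(u, if Suc u = n then 0 else Suc u) \<in> parcs (cycle_graph n)"
      "(u, if u = 0 then n - 1 else u - 1) \<in> parcs (cycle_graph n)"
      using uv by (auto simp: cycle_graph_def)
    with cyc_dist_neighbour[OF uv] show ?thesis by blast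
  qed
  moreover have "cyc_dist n u v \<le> Suc (cyc_dist n u' v)"
    if "(u, u') \<in> parcs (cycle_graph n)" "v < n" for u u' v
  proof -
    have "u < n" "u' < n"
      "u' = (if Suc u = n then 0 else Suc u) \<or> u = (if Suc u' = n then 0 else Suc u')"
      using that(1) by (auto simp: cycle_graph_def mod_Suc)
    then consider "Suc u < n" "u' = Suc u" | "Suc u' < n" "u = Suc u'"
      | "u = n - 1" "u' = 0" | "u' = n - 1" "u = 0"
      by (force split: if_splits)
    then show ?thesis using cyc_dist_Suc cyc_dist_wrap that(2) by cases auto
  qed
  moreover have "cyc_dist n u v = 0 \<longleftrightarrow> u = v" if "u < n" "v < n" for u v
    using that by (auto simp: cyc_dist_def absdiff_def Let_def min_def)
  moreover have "pverts (cycle_graph n) = {..<n}"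
    by (simp add: cycle_graph_def)
  ultimately show ?thesis unfolding step_metric_def by auto
qed

definition torus_dist :: "nat \<Rightarrow> nat \<times> nat \<Rightarrow> nat \<times> nat \<Rightarrow> nat" where
  "torus_dist n = (\<lambda>(a, b) (a', b'). cyc_dist n a a' + cyc_dist n b b')"

text \<open>The product associates to the left, so a vertex pairs a point of the torus with a
  height.\<close>

lemma graph_dist_cycles:
  assumes "n \<ge> 3" "m \<ge> 3" "p \<in> {..<n} \<times> {..<n}" "q \<in> {..<n} \<times> {..<n}" "z < m" "z' < m"
  shows "graph_dist (with_proj (cycle_graph n \<box> cycle_graph n \<box> cycle_graph m)) (p, z) (q, z') =
    ereal (real (torus_dist n p q + cyc_dist m z z'))"
proof -
  note C = pair_graph_cycle_graph[OF assms(1)] pair_graph_cycle_graph[OF assms(2)]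
  have "step_metric (cycle_graph n \<box> cycle_graph n) (torus_dist n)"
    unfolding torus_dist_def
    by (intro step_metric_cartesian_product step_metric_cycle_graph C assms)
  then have "step_metric (cycle_graph n \<box> cycle_graph n \<box> cycle_graph m)
      (\<lambda>(a, b) (a', b'). torus_dist n a a' + cyc_dist m b b')"
    by (intro step_metric_cartesian_product pair_graph_cartesian_product step_metric_cycle_graph C assms)
  from graph_dist_step_metric[OF pair_graph_cartesian_product[OF pair_graph_cartesian_product] this]
  have "graph_dist (with_proj (cycle_graph n \<box> cycle_graph n \<box> cycle_graph m)) u v =
      ereal (real ((case u of (a, b) \<Rightarrow> \<lambda>(a', b'). torus_dist n a a' + cyc_dist m b b') v))"
    if "u \<in> pverts (cycle_graph n \<box> cycle_graph n \<box> cycle_graph m)"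
      "v \<in> pverts (cycle_graph n \<box> cycle_graph n \<box> cycle_graph m)" for u v
    using that C by blast
  moreover have "(p, z) \<in> pverts (cycle_graph n \<box> cycle_graph n \<box> cycle_graph m)"
    "(q, z') \<in> pverts (cycle_graph n \<box> cycle_graph n \<box> cycle_graph m)"
    using assms by (auto simp: cartesian_product_def cycle_graph_def)
  ultimately show ?thesis
    by simp
qed

section \<open>Cyclic distance and modular shifts\<close>

lemma cyc_dist_shift_le:
  assumes "x < n"
  shows "cyc_dist n x ((x + c) mod n) \<le> c"
proof -
  define r where "r = c mod n"
  have r: "r < n" "r \<le> c" using assms by (auto simp: r_def)
  have "(x + c) mod n = (x + r) mod n" by (simp add: r_def mod_simps)
  also have "\<dots> = (if x + r < n then x + r else x + r - n)"
    using assms r by (simp add: mod_if)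
  finally show ?thesis using assms r by (auto simp: cyc_dist_def absdiff_def Let_def min_def)
qed

text \<open>A window may wrap around a short cycle, so this is only an upper bound, the direction
  that covering uses.\<close>

lemma cyc_dist_window_le:
  assumes "0 < n"
  shows "cyc_dist n ((b + i) mod n) ((b + j) mod n) \<le> absdiff i j"
proof -
  have le: "cyc_dist n ((b + i) mod n) ((b + j) mod n) \<le> j - i" if "i \<le> j" for i j
  proof -
    have "((b + i) mod n + (j - i)) mod n = (b + i + (j - i)) mod n"
      by (rule mod_add_left_eq)
    also have "b + i + (j - i) = b + j" using that by simp
    finally have "((b + i) mod n + (j - i)) mod n = (b + j) mod n" .
    then show ?thesis using cyc_dist_shift_le[of "(b + i) mod n" n "j - i"] assms by simp
  qed
  show ?thesis
    using le[of i j] le[of j i] by (simp add: absdiff_def cyc_dist_sym)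
qed

text \<open>The shorter arc leads forward from \<open>x\<close> or from \<open>y\<close>. Hence two
  close layers can be compared in a window that starts at one of them.\<close>

lemma cyc_dist_shift_cases:
  assumes "x < n" "y < n"
  shows "y = (x + cyc_dist n x y) mod n \<or> x = (y + cyc_dist n x y) mod n"
proof -
  have *: "y = (x + cyc_dist n x y) mod n \<or> x = (y + cyc_dist n x y) mod n"
    if "x \<le> y" "x < n" "y < n" for x y
    using that by (cases "y - x \<le> n - (y - x)") (auto simp: cyc_dist_def absdiff_def Let_def min_def)
  show ?thesis using *[of x y] *[of y x] assms by (metis cyc_dist_sym linear)
qed

section \<open>Codes built from layers\<close>

fun walks :: "('l \<Rightarrow> 'l list) \<Rightarrow> nat \<Rightarrow> 'l \<Rightarrow> 'l list list" where
  "walks f 0 i = [[i]]"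
| "walks f (Suc k) i = concat (map (\<lambda>j. map ((#) i) (walks f k j)) (f i))"

definition window :: "nat \<Rightarrow> (nat \<Rightarrow> 'l) \<Rightarrow> nat \<Rightarrow> nat \<Rightarrow> 'l list" where
  "window m s k z = map (\<lambda>j. s ((z + j) mod m)) [0..<Suc k]"

text \<open>Reduces conditions on cyclic sequences of any length to finitely many label
  sequences.\<close>

lemma window_in_walks:
  assumes "\<And>z. z < m \<Longrightarrow> s (Suc z mod m) \<in> set (f (s z))" and "z < m"
  shows "window m s k z \<in> set (walks f k (s z))"
  using assms(2)
proof (induction k arbitrary: z)
  case 0
  then show ?case by (simp add: window_def)
next
  case (Suc k)
  have "Suc z mod m < m" using Suc.prems by simp
  moreover have "(z + Suc j) mod m = (Suc z mod m + j) mod m" for j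
    by (metis add_Suc_shift mod_add_left_eq)
  then have "window m s (Suc k) z = s z # window m s k (Suc z mod m)"
    using Suc.prems by (simp add: window_def map_upt_Suc del: upt_Suc add_Suc_right)
  ultimately show ?case
    using Suc.IH[of "Suc z mod m"] assms(1)[OF Suc.prems] by auto
qed

text \<open>Heights are recorded as offsets into the window, which makes the checks independent of
  \<open>m\<close>.\<close>

definition window_points :: "('l \<Rightarrow> (nat \<times> nat) list) \<Rightarrow> 'l list \<Rightarrow> (nat \<times> nat \<times> nat) list" where
  "window_points L w = concat (map (\<lambda>(j, l). map (\<lambda>(a, b). (a, b, j)) (L l)) (List.enumerate 0 w))"

lemma window_points_iff:
  "(a, b, j) \<in> set (window_points L w) \<longleftrightarrow> j < length w \<and> (a, b) \<in> set (L (w ! j))"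
  by (force simp: window_points_def in_set_enumerate_eq)

definition packing_window :: "nat \<Rightarrow> ('l \<Rightarrow> (nat \<times> nat) list) \<Rightarrow> 'l list \<Rightarrow> bool" where
  "packing_window n L w \<longleftrightarrow> (\<forall>(x, y)\<in>set (L (hd w)). \<forall>(a, b, j)\<in>set (window_points L w).
     cyc_dist n x a + cyc_dist n y b + j \<le> 4 \<longrightarrow> j = 0 \<and> x = a \<and> y = b)"

text \<open>Filtering by the first coordinate before running through the second one keeps the evaluation
  of the covering check cheap.\<close>

definition covering_window :: "nat \<Rightarrow> ('l \<Rightarrow> (nat \<times> nat) list) \<Rightarrow> 'l list \<Rightarrow> bool" where
  "covering_window n L w \<longleftrightarrow> (let C = window_points L w in
     \<forall>x\<in>set [0..<n]. let C' = filter (\<lambda>(a, b, j). cyc_dist n x a + absdiff 3 j \<le> 3) C in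
       \<forall>y\<in>set [0..<n]. \<exists>(a, b, j)\<in>set C'. cyc_dist n x a + cyc_dist n y b + absdiff 3 j \<le> 3)"

text \<open>The middle of a window of five layers has offset 2. A point \<open>p\<close> there at
  distance above 2 from all codewords rules out covering radius 2.\<close>

definition hole_window ::
    "nat \<Rightarrow> ('l \<Rightarrow> (nat \<times> nat) list) \<Rightarrow> nat \<times> nat \<Rightarrow> 'l list \<Rightarrow> bool" where
  "hole_window n L p w \<longleftrightarrow> (\<forall>(a, b, j)\<in>set (window_points L w).
     2 < cyc_dist n (fst p) a + cyc_dist n (snd p) b + absdiff 2 j)"

text \<open>The length \<open>e\<close> of the packing windows is 4, except in \<open>C\<^sub>4\<close>: no two vertices have distance
  greater than 2 there, and a longer window would meet its first layer again.\<close>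

definition layers_check ::
    "nat \<Rightarrow> nat \<Rightarrow> (nat \<times> nat) list list \<Rightarrow> (nat \<Rightarrow> nat list) \<Rightarrow> nat \<Rightarrow> nat \<times> nat \<Rightarrow> bool" where
  "layers_check n e Ls f h p \<longleftrightarrow>
     (\<forall>L\<in>set Ls. \<forall>(x, y)\<in>set L. x < n \<and> y < n) \<and>
     (\<forall>i\<in>set [0..<length Ls].
        (\<forall>w\<in>set (walks f e i). packing_window n (\<lambda>l. Ls ! l) w) \<and>
        (\<forall>w\<in>set (walks f 6 i). covering_window n (\<lambda>l. Ls ! l) w)) \<and>
     fst p < n \<and> snd p < n \<and> (\<forall>w\<in>set (walks f 4 h). hole_window n (\<lambda>l. Ls ! l) p w)"

lemma quasi_perfect_layers:
  assumes nm: "n \<ge> 3" "m \<ge> 3" and em: "e \<ge> 4 \<or> m \<le> 2 * e + 1"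
    and check: "layers_check n e Ls f h p"
    and s: "\<And>z. z < m \<Longrightarrow> s z < length Ls"
    and step: "\<And>z. z < m \<Longrightarrow> s (Suc z mod m) \<in> set (f (s z))"
    and h: "h \<in> s ` {..<m}"
  shows "\<exists>D. quasi_perfect (with_proj (cycle_graph n \<box> cycle_graph n \<box> cycle_graph m)) 2 D"
proof
  let ?G = "with_proj (cycle_graph n \<box> cycle_graph n \<box> cycle_graph m)"
  let ?L = "\<lambda>l. Ls ! l"
  define D where "D = {(q, z). z < m \<and> q \<in> set (Ls ! s z)}"
  have verts: "verts ?G = ({..<n} \<times> {..<n}) \<times> {..<m}"
    by (simp add: cartesian_product_def cycle_graph_def)
  have in_range: "q \<in> {..<n} \<times> {..<n}" if "(q, z) \<in> D" for q z
  proof -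
    have "Ls ! s z \<in> set Ls" "q \<in> set (Ls ! s z)" using that s by (auto simp: D_def)
    then show ?thesis using check unfolding layers_check_def by fast
  qed
  have dist: "graph_dist ?G (q, z) (q', z') = ereal (real (torus_dist n q q' + cyc_dist m z z'))"
    if "q \<in> {..<n} \<times> {..<n}" "q' \<in> {..<n} \<times> {..<n}" "z < m" "z' < m" for q q' z z'
    using graph_dist_cycles[OF nm that] .
  have nth_window: "window m s k z ! j = s ((z + j) mod m)" if "j \<le> k" for k z j
    using that by (simp add: window_def del: upt_Suc)
  have length_window: "length (window m s k z) = Suc k" for k z
    by (simp add: window_def)
  have packing: "j = 0 \<and> q = q'"
    if "z < m" "q \<in> set (Ls ! s z)" "q' \<in> set (Ls ! s ((z + j) mod m))" "j \<le> e"
      "torus_dist n q q' + j \<le> 4" for z q q' j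
  proof -
    have "packing_window n ?L (window m s e z)"
      using check s[OF that(1)] window_in_walks[of m s f, OF step that(1)]
      unfolding layers_check_def by auto
    moreover have "hd (window m s e z) = s z"
      using that(1) by (simp add: window_def hd_map del: upt_Suc)
    moreover obtain x y a b where "q = (x, y)" "q' = (a, b)" by (cases q, cases q')
    moreover from this have "(a, b, j) \<in> set (window_points ?L (window m s e z))"
      using that by (simp add: window_points_iff length_window nth_window)
    ultimately show ?thesis
      using that unfolding packing_window_def torus_dist_def by fastforce
  qed
  have separated: "5 \<le> torus_dist n q q' + cyc_dist m z z'"
    if "(q, z) \<in> D" "(q', z') \<in> D" "(q, z) \<noteq> (q', z')" for q z q' z'
  proof (rule ccontr)
    assume "\<not> ?thesis"
    then have le: "torus_dist n q q' + cyc_dist m z z' \<le> 4" by simp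
    have z: "z < m" "z' < m" and mem: "q \<in> set (Ls ! s z)" "q' \<in> set (Ls ! s z')"
      using that by (auto simp: D_def)
    obtain c where c: "cyc_dist m z z' = c" by blast
    \<comment> \<open>For \<open>e\<close> below 4 this holds because a cyclic distance is at most
      half of \<open>m\<close>.\<close>
    have ce: "c \<le> e"
      using em le z c by (auto simp: cyc_dist_def absdiff_def Let_def min_def split: if_splits)
    have "c = 0 \<and> q = q'"
    proof (cases "z' = (z + c) mod m")
      case True
      then show ?thesis using packing[OF z(1) mem(1), of q' c] mem(2) ce le c by auto
    next
      case False
      then have "z = (z' + c) mod m" using cyc_dist_shift_cases[OF z] c by auto
      moreover have "torus_dist n q' q = torus_dist n q q'"
        by (simp add: torus_dist_def cyc_dist_sym split: prod.splits)
      ultimately show ?thesis using packing[OF z(2) mem(2), of q c] mem(1) ce le c by auto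
    qed
    moreover from this have "z = z'"
      using cyc_dist_shift_cases[OF z] z c by auto
    ultimately show False using that by simp
  qed
  have covered: "\<exists>(q', z')\<in>D. torus_dist n q q' + cyc_dist m z z' \<le> 3"
    if q: "q \<in> {..<n} \<times> {..<n}" and z: "z < m" for q z
  proof -
    \<comment> \<open>The window starts three layers before \<open>z\<close>, which puts
      \<open>z\<close> at the central offset 3.\<close>
    define b where "b = (z + (m - 3)) mod m"
    have b: "b < m" using z by (simp add: b_def)
    have bz: "(b + 3) mod m = z" using z nm by (simp add: b_def mod_simps)
    have "covering_window n ?L (window m s 6 b)"
      using check s[OF b] window_in_walks[of m s f, OF step b]
      unfolding layers_check_def by auto
    then obtain x y j where j: "(x, y, j) \<in> set (window_points ?L (window m s 6 b))"
      and le: "torus_dist n q (x, y) + absdiff 3 j \<le> 3"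
      using q unfolding covering_window_def torus_dist_def Let_def by fastforce
    let ?z = "(b + j) mod m"
    have "((x, y), ?z) \<in> D"
      using j nm nth_window[of j 6 b] by (auto simp: window_points_iff length_window D_def)
    moreover have "cyc_dist m z ?z \<le> absdiff 3 j"
      using cyc_dist_window_le[of m b 3 j] nm bz by simp
    ultimately show ?thesis using le by (intro bexI[of _ "((x, y), ?z)"]) auto
  qed
  obtain z0 where z0: "z0 < m" "s z0 = h" using h by auto
  have hole: "2 < torus_dist n p q + cyc_dist m ((z0 + 2) mod m) z"
    if "(q, z) \<in> D" for q z
  proof (rule ccontr)
    assume neg: "\<not> ?thesis"
    let ?c = "(z0 + 2) mod m"
    define d where "d = cyc_dist m ?c z"
    have d2: "d \<le> 2" using neg by (simp add: d_def)
    have z: "z < m" "q \<in> set (Ls ! s z)" using that by (auto simp: D_def)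
    \<comment> \<open>The layer \<open>?c\<close> has offset 2, so a layer at distance
      \<open>d\<close> from it appears at offset \<open>2 + d\<close> or
      \<open>2 - d\<close>.\<close>
    have "\<exists>j\<le>4. z = (z0 + j) mod m \<and> absdiff 2 j = d"
    proof (cases "z = (?c + d) mod m")
      case True
      then show ?thesis using d2
        by (intro exI[of _ "2 + d"]) (auto simp: mod_simps absdiff_def add.assoc)
    next
      case False
      then have "?c = (z + d) mod m"
        using cyc_dist_shift_cases[of ?c m z] z nm unfolding d_def by auto
      then have "(z0 + (2 - d) + d) mod m = (z + d) mod m" using d2 by simp
      then have "(z0 + (2 - d)) mod m = z mod m"
        by (simp add: nat_mod_eq_iff add.assoc)
      then show ?thesis using d2 z
        by (intro exI[of _ "2 - d"]) (auto simp: absdiff_def)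
    qed
    then obtain j where j: "j \<le> 4" "z = (z0 + j) mod m" "absdiff 2 j = d" by blast
    obtain a b where ab: "q = (a, b)" by (cases q)
    have "hole_window n ?L p (window m s 4 z0)"
      using check window_in_walks[of m s f, OF step z0(1), of 4] z0
      unfolding layers_check_def by auto
    moreover have "(a, b, j) \<in> set (window_points ?L (window m s 4 z0))"
      using j z ab by (simp add: window_points_iff length_window nth_window)
    ultimately have "2 < torus_dist n p q + d"
      using j ab by (fastforce simp: hole_window_def torus_dist_def split: prod.splits)
    then show False using neg by (simp add: d_def)
  qed
  have p: "p \<in> {..<n} \<times> {..<n}"
    using check by (cases p) (auto simp: layers_check_def)
  have "error_correcting ?G 2 D"
    unfolding error_correcting_def verts
  proof (intro conjI ballI impI)
    show "D \<subseteq> ({..<n} \<times> {..<n}) \<times> {..<m}"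
      using in_range by (auto simp: D_def)
    fix c c' assume cc': "c \<in> D" "c' \<in> D" "c \<noteq> c'"
    obtain q z q' z' where c: "c = (q, z)" "c' = (q', z')" by (cases c, cases c')
    then have "z < m" "z' < m" using cc' by (auto simp: D_def)
    then show "ereal (real (2 * 2 + 1)) \<le> graph_dist ?G c c'"
      using separated[of q z q' z'] cc' in_range c by (simp add: dist)
  qed
  moreover have "covers ?G D 3"
    unfolding covers_def verts
  proof
    fix v assume "v \<in> ({..<n} \<times> {..<n}) \<times> {..<m}"
    then obtain q z where v: "v = (q, z)" "q \<in> {..<n} \<times> {..<n}" "z < m" by auto
    then obtain q' z' where "(q', z') \<in> D" "torus_dist n q q' + cyc_dist m z z' \<le> 3"
      using covered by blast
    moreover from this have "z' < m" by (simp add: D_def)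
    ultimately show "\<exists>c\<in>D. graph_dist ?G v c \<le> ereal (real 3)"
      using v in_range by (intro bexI[of _ "(q', z')"]) (simp_all add: dist)
  qed
  moreover have "3 \<le> r" if "covers ?G D r" for r
  proof -
    let ?c = "(z0 + 2) mod m"
    have c: "?c < m" using nm by simp
    then have "(p, ?c) \<in> verts ?G" using p verts by simp
    then obtain q z where q: "(q, z) \<in> D" "graph_dist ?G (p, ?c) (q, z) \<le> ereal (real r)"
      using \<open>covers ?G D r\<close> unfolding covers_def by fast
    then have "z < m" by (simp add: D_def)
    then have "torus_dist n p q + cyc_dist m ?c z \<le> r"
      using q p c in_range by (simp add: dist)
    then show ?thesis using hole[OF q(1)] by simp
  qed
  ultimately show "quasi_perfect ?G 2 D"
    by (simp add: quasi_perfect_def has_covering_radius_def)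
qed

section \<open>The codes\<close>

definition cyclic_succ :: "nat \<Rightarrow> nat \<Rightarrow> nat list" where
  "cyclic_succ c i = [Suc i mod c]"

text \<open>The number of layers divides the length of the cycle, so reduction modulo it is
  compatible with wrapping around.\<close>

lemma quasi_perfect_periodic_layers:
  assumes "layers_check n 4 Ls (cyclic_succ (length Ls)) 0 p" "n \<ge> 3" "length Ls \<ge> 3" "k \<ge> 1"
  shows "\<exists>D. quasi_perfect
    (with_proj (cycle_graph n \<box> cycle_graph n \<box> cycle_graph (length Ls * k))) 2 D"
proof (rule quasi_perfect_layers[where e = 4 and s = "\<lambda>z. z mod length Ls"])
  let ?l = "length Ls"
  have l: "?l \<le> ?l * k" using assms(4) by simp
  show "3 \<le> ?l * k" using l assms(3) by linarith
  show "Suc z mod (?l * k) mod ?l \<in> set (cyclic_succ ?l (z mod ?l))" for z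
    by (simp add: cyclic_succ_def mod_mod_cancel mod_Suc_eq)
  show "0 \<in> (\<lambda>z. z mod ?l) ` {..<?l * k}" using l assms(3)
    by (intro image_eqI[of _ _ 0]) auto
  show "z mod ?l < ?l" for z using assms(3) by (intro mod_less_divisor) linarith
qed (use assms in auto)

definition line :: "nat \<Rightarrow> nat \<Rightarrow> nat \<Rightarrow> (nat \<times> nat) list" where
  "line n a b = map (\<lambda>x. (x, (a * x + b) mod n)) [0..<n]"

text \<open>The next three codes were found with a SAT solver.\<close>

definition layers14_8 :: "(nat \<times> nat) list list" where
  "layers14_8 = map (concat \<circ> map (\<lambda>(x, y). [(x, y), (x + 7, (y + 7) mod 14)]))
    [[(3, 7), (3, 12), (5, 4)],
     [(1, 1), (5, 0)],
     [(0, 5), (1, 11), (4, 9)],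
     [(2, 3), (5, 6)],
     [(2, 8), (2, 13), (5, 2)],
     [(3, 5), (4, 11), (6, 8)],
     [(0, 12), (3, 1), (6, 13)],
     [(0, 3), (1, 9)]]"

definition layers17 :: "(nat \<times> nat) list list" where
  "layers17 =
    [[(1, 11), (3, 0), (4, 13), (8, 6), (9, 14), (11, 11), (12, 16), (16, 2)],
     [(0, 15), (2, 5), (3, 9), (7, 11), (7, 16), (9, 2), (10, 8), (13, 5), (15, 9)],
     [(0, 7), (1, 1), (5, 3), (6, 7), (13, 1), (15, 13)],
     [(3, 12), (4, 16), (9, 12), (10, 5), (11, 15), (12, 10), (15, 4)],
     [(1, 14), (2, 3), (2, 8), (6, 14), (7, 4), (8, 9), (9, 0), (13, 7), (15, 0), (16, 10)],
     [(4, 6), (5, 10), (6, 1), (11, 3), (13, 13), (16, 6)]]"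

definition layers19 :: "(nat \<times> nat) list list" where
  "layers19 =
    [[(3, 2), (3, 7), (5, 16), (6, 10), (8, 6), (11, 13), (11, 18), (14, 10), (15, 4)],
     [(0, 4), (2, 13), (5, 4), (6, 0), (9, 16), (10, 9), (11, 4), (13, 15), (16, 12), (17, 8)],
     [(1, 18), (2, 9), (7, 12), (10, 1), (14, 0), (14, 7), (17, 2), (17, 16)],
     [(2, 3), (4, 15), (6, 8), (7, 3), (10, 6), (10, 14), (13, 11), (16, 5), (18, 11)],
     [(0, 6), (4, 0), (4, 5), (4, 11), (8, 17), (9, 10), (12, 16), (13, 2), (15, 13), (16, 9)],
     [(0, 14), (1, 10), (2, 17), (7, 14), (9, 2), (12, 7), (16, 17), (18, 1)]]"

definition layers14 :: "(nat \<times> nat) list list" where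
  "layers14 = [line 14 4 0, [], [], line 14 4 7, [], []]"

text \<open>The arc from 0 to 2 skips the empty layer 1 and turns the block \<open>A--B--\<close> into \<open>A-B--\<close>.\<close>

definition succ14 :: "nat \<Rightarrow> nat list" where
  "succ14 i = (if i = 0 then [1, 2] else [Suc i mod 6])"

text \<open>First come \<open>a\<close> blocks of length 6, then blocks of length 5, where every
  offset but 0 is raised by one to skip label 1.\<close>

definition label14 :: "nat \<Rightarrow> nat \<Rightarrow> nat" where
  "label14 a z = (if z < 6 * a then z mod 6
     else if (z - 6 * a) mod 5 = 0 then 0 else Suc ((z - 6 * a) mod 5))"

text \<open>Every block starts with label 0 and ends with label 5, so blocks of both lengths join
  freely, also across the wrap.\<close>

lemma label14_step:
  assumes "z < 6 * a + 5 * b"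
  shows "label14 a (Suc z mod (6 * a + 5 * b)) \<in> set (succ14 (label14 a z))"
proof (cases "z < 6 * a")
  case True
  then consider "Suc z < 6 * a" | "Suc z = 6 * a" by linarith
  then show ?thesis
  proof cases
    case 1
    then show ?thesis by (simp add: label14_def succ14_def mod_Suc)
  next
    case 2
    then obtain a' where "a = Suc a'" by (cases a) auto
    with 2 have "z = 5 + 6 * a'" by simp
    then have "z mod 6 = 5" by simp
    \<comment> \<open>The last long block is followed by the first short one or, if
      \<open>b = 0\<close>, by the first layer again.\<close>
    moreover have "label14 a (6 * a mod (6 * a + 5 * b)) = 0"
      by (cases "b = 0") (simp_all add: label14_def)
    ultimately show ?thesis using 2 by (simp add: label14_def succ14_def)
  qed
next
  case False
  define y where "y = z - 6 * a"
  have y: "y < 5 * b" "z = 6 * a + y" using False assms by (auto simp: y_def)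
  have "label14 a (Suc z mod (6 * a + 5 * b)) = (if Suc y mod 5 = 0 then 0 else Suc (Suc y mod 5))"
  proof (cases "Suc y = 5 * b")
    case True
    then have "Suc z = 6 * a + 5 * b" using y by simp
    then have "Suc z mod (6 * a + 5 * b) = 0" by simp
    then show ?thesis using True by (simp add: label14_def)
  next
    case False
    then have "Suc z mod (6 * a + 5 * b) = 6 * a + Suc y" using y by simp
    then show ?thesis by (simp add: label14_def)
  qed
  moreover have "label14 a z = (if y mod 5 = 0 then 0 else Suc (y mod 5))"
    using y by (simp add: label14_def)
  ultimately show ?thesis by (auto simp: succ14_def mod_Suc)
qed

text \<open>The hole window starts at label 2, which both kinds of block contain and from which four
  arcs are forced. The hole lies in the empty layer 4, just after \<open>B\<close>.\<close>

lemma layers14_check: "layers_check 14 4 layers14 succ14 2 (0, 1)"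
  by code_simp

lemma quasi_perfect_14:
  assumes "0 < a + b"
  shows "\<exists>D. quasi_perfect
    (with_proj (cycle_graph 14 \<box> cycle_graph 14 \<box> cycle_graph (6 * a + 5 * b))) 2 D"
proof (rule quasi_perfect_layers[OF _ _ _ layers14_check])
  show "label14 a z < length layers14" for z
    by (auto simp: label14_def layers14_def less_Suc_eq_le)
  \<comment> \<open>Label 2 has offset 1 in a short block and offset 2 in a long one.\<close>
  show "2 \<in> label14 a ` {..<6 * a + 5 * b}"
    by (rule image_eqI[of _ _ "if a = 0 then 1 else 2"]) (use assms in \<open>auto simp: label14_def\<close>)
qed (use assms label14_step in auto)

lemma quasi_perfect_14_4:
  "\<exists>D. quasi_perfect (with_proj (cycle_graph 14 \<box> cycle_graph 14 \<box> cycle_graph 4)) 2 D"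
proof (rule quasi_perfect_layers[where s = "\<lambda>z. z"])
  show "layers_check 14 2 [line 14 4 0, [], line 14 4 7, []] (cyclic_succ 4) 1 (0, 2)"
    by code_simp
qed (auto simp: cyclic_succ_def)

lemma quasi_perfect_14_8:
  "\<exists>D. quasi_perfect (with_proj (cycle_graph 14 \<box> cycle_graph 14 \<box> cycle_graph 8)) 2 D"
proof -
  have "layers_check 14 4 layers14_8 (cyclic_succ 8) 0 (0, 0)"
    by code_simp
  moreover have "length layers14_8 = 8" by (simp add: layers14_8_def)
  ultimately show ?thesis
    using quasi_perfect_periodic_layers[of 14 layers14_8 "(0, 0)" 1] by simp
qed

lemma quasi_perfect_6:
  assumes "14 \<le> n" "n \<le> 19" "k \<ge> 1"
  shows "\<exists>D. quasi_perfect (with_proj (cycle_graph n \<box> cycle_graph n \<box> cycle_graph (6 * k))) 2 D"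
proof -
  have periodic: ?thesis
    if "layers_check n 4 Ls (cyclic_succ 6) 0 p" "length Ls = 6" for Ls p
    using quasi_perfect_periodic_layers[of n Ls p k] that assms by simp
  consider "n = 14" | "n = 15" | "n = 16" | "n = 17" | "n = 18" | "n = 19"
    using assms by linarith
  then show ?thesis
  proof cases
    case 1
    then show ?thesis using quasi_perfect_14[of k 0] assms by simp
  next
    case 2
    have "layers_check 15 4 [line 15 4 0, [], [], line 15 4 5, [], []] (cyclic_succ 6) 0 (0, 2)"
      by code_simp
    with 2 show ?thesis by (intro periodic) auto
  next
    case 3
    \<comment> \<open>A line of slope 3 is split by the parity of \<open>x\<close> over two
      consecutive layers; after an empty layer its translate by 8 is split likewise.\<close>
    have "layers_check 16 4 [filter (odd \<circ> fst) (line 16 3 6), filter (even \<circ> fst) (line 16 3 6), [],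
        filter (odd \<circ> fst) (line 16 3 14), filter (even \<circ> fst) (line 16 3 14), []]
      (cyclic_succ 6) 0 (0, 0)"
      by code_simp
    with 3 show ?thesis by (intro periodic) auto
  next
    case 4
    have "layers_check 17 4 layers17 (cyclic_succ 6) 0 (0, 3)"
      by code_simp
    with 4 show ?thesis by (intro periodic) (auto simp: layers17_def)
  next
    case 5
    \<comment> \<open>Three parallel lines, successive translates by 6, occupy every second
      layer.\<close>
    have "layers_check 18 4 [line 18 4 0, [], line 18 4 6, [], line 18 4 12, []]
      (cyclic_succ 6) 0 (0, 13)"
      by code_simp
    with 5 show ?thesis by (intro periodic) auto
  next
    case 6
    have "layers_check 19 4 layers19 (cyclic_succ 6) 0 (0, 1)"
      by code_simp
    with 6 show ?thesis by (intro periodic) (auto simp: layers19_def)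
  qed
qed

lemma quasi_perfect_4:
  assumes "k \<ge> 1"
  shows "\<exists>D. quasi_perfect (with_proj (cycle_graph 14 \<box> cycle_graph 14 \<box> cycle_graph (4 * k))) 2 D"
proof -
  consider "k = 1" | "k = 2" | "k \<ge> 3" using assms by linarith
  then show ?thesis
  proof cases
    case 1
    then show ?thesis using quasi_perfect_14_4 by simp
  next
    case 2
    then show ?thesis using quasi_perfect_14_8 by simp
  next
    case 3
    \<comment> \<open>For \<open>k = 3q + r\<close> one has \<open>4k = 6(2q - r) + 5(2r)\<close>;
      as \<open>q \<ge> 1\<close> and \<open>r \<le> 2\<close>, the subtraction does not
      truncate.\<close>
    define a b where "a = 2 * (k div 3) - k mod 3" and "b = 2 * (k mod 3)"
    have "k = 3 * (k div 3) + k mod 3" "k mod 3 \<le> 2" "1 \<le> k div 3" using 3 by auto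
    then have "4 * k = 6 * a + 5 * b" unfolding a_def b_def by linarith
    moreover from this 3 have "0 < a + b" by linarith
    ultimately show ?thesis using quasi_perfect_14[of a b] by simp
  qed
qed

theorem theorem11:
  fixes k :: nat
  assumes "k \<ge> 1"
  shows "(\<exists>D. quasi_perfect
            (with_proj (cycle_graph 14 \<box> cycle_graph 14 \<box> cycle_graph (4 * k))) 2 D) \<and>
         (\<forall>n::nat. 14 \<le> n \<and> n \<le> 19 \<longrightarrow>
            (\<exists>D. quasi_perfect
              (with_proj (cycle_graph n \<box> cycle_graph n \<box> cycle_graph (6 * k))) 2 D))"
  using quasi_perfect_4[OF assms] quasi_perfect_6[OF _ _ assms] by blast

end
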